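(* Let $\boldsymbol{X}\in\mathbb{R}^{N\times P}$ and let $\boldsymbol{W}_\ell\in\mathbb{R}^{N_{\ell-1}\times N_\ell}$, $\ell=1,\dots,L$, with $N_0=N$, be the weight matrices of a ReLU network with $\|\boldsymbol{W}_\ell\|_1=1$ for $\ell=1,\dots,L$, and let the layer outcomes be $\boldsymbol{X}^{(0)}=\boldsymbol{X}$, $\boldsymbol{X}^{(\ell)}=\mathrm{ReLU}(\boldsymbol{W}_\ell^\top\boldsymbol{X}^{(\ell-1)})$. Let $\epsilon\ge 0$ and let $\gamma_\ell\ge 1$ for $\ell=2,\dots,L$ be inflation rates. Suppose the network is retrained by the cascade Net-Trim scheme (with parameters $\epsilon$ and $\gamma_2,\dots,\gamma_L$) described in the context, producing retrained matrices $\hat{\boldsymbol{W}}_\ell$ and retrained layer outcomes $\hat{\boldsymbol{X}}^{(\ell)}$. Then for $\ell=1,\dots,L$, $$\big\|\hat{\boldsymbol{X}}^{(\ell)}-\boldsymbol{X}^{(\ell)}\big\|_F\le\epsilon\prod_{j=2}^{\ell}\gamma_j$$ (with the empty product equal to $1$).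
   Context: $\mathrm{ReLU}$ acts entrywise: $(\mathrm{ReLU}(\boldsymbol{X}))_{m,n}=\max(x_{m,n},0)$. For a matrix, $\|\boldsymbol{X}\|_1=\sum_{m,n}|x_{m,n}|$ is the sum of absolute values of the entries (not the induced norm), and $\|\cdot\|_F$ is the Frobenius norm. For an index set $\Omega$ of entries, $\boldsymbol{W}_\Omega$ is the matrix of the same size as $\boldsymbol{W}$ that agrees with $\boldsymbol{W}$ on $\Omega$ and is zero off $\Omega$; $\Omega^c$ is the complement of $\Omega$; $\operatorname{supp}\boldsymbol{Y}$ is the set of indices of nonzero entries of $\boldsymbol{Y}$. For matrices $\boldsymbol{X}\in\mathbb{R}^{n\times P}$, $\boldsymbol{Y},\boldsymbol{V}\in\mathbb{R}^{m\times P}$ and $\epsilon\ge0$, with $\Omega=\operatorname{supp}\boldsymbol{Y}$, the set $\mathcal{C}_\epsilon(\boldsymbol{X},\boldsymbol{Y},\boldsymbol{V})$ consists of all $\boldsymbol{U}\in\mathbb{R}^{n\times m}$ such that $\|(\boldsymbol{U}^\top\boldsymbol{X}-\boldsymbol{Y})_\Omega\|_F\le\epsilon$ and $(\boldsymbol{U}^\top\boldsymbol{X})_{\Omega^c}\le\boldsymbol{V}_{\Omega^c}$ (entrywise). Cascade Net-Trim scheme: first, $\hat{\boldsymbol{W}}_1$ is a minimizer of $\|\boldsymbol{U}\|_1$ over $\boldsymbol{U}\in\mathcal{C}_\epsilon(\boldsymbol{X},\boldsymbol{X}^{(1)},\boldsymbol{0})$, and $\hat{\boldsymbol{X}}^{(1)}=\mathrm{ReLU}(\hat{\boldsymbol{W}}_1^\top\boldsymbol{X})$.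 Then, successively for $\ell=2,\dots,L$: set $\Omega=\operatorname{supp}\boldsymbol{X}^{(\ell)}$ and $\epsilon_\ell=\gamma_\ell\,\|(\boldsymbol{W}_\ell^\top\hat{\boldsymbol{X}}^{(\ell-1)}-\boldsymbol{X}^{(\ell)})_\Omega\|_F$; let $\hat{\boldsymbol{W}}_\ell$ be a minimizer of $\|\boldsymbol{U}\|_1$ over $\boldsymbol{U}\in\mathcal{C}_{\epsilon_\ell}\big(\hat{\boldsymbol{X}}^{(\ell-1)},\boldsymbol{X}^{(\ell)},\boldsymbol{W}_\ell^\top\hat{\boldsymbol{X}}^{(\ell-1)}\big)$; and set $\hat{\boldsymbol{X}}^{(\ell)}=\mathrm{ReLU}(\hat{\boldsymbol{W}}_\ell^\top\hat{\boldsymbol{X}}^{(\ell-1)})$. *)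

theory Defs
  imports Complex_Main "Jordan_Normal_Form.Matrix"
begin

text \<open>
  The layer widths vary with the layer, so matrices are those of \<^theory>\<open>Jordan_Normal_Form.Matrix\<close>,
  whose dimensions are natural numbers. Rows and columns are indexed from 0. The order on
  matrices is the entrywise one, which includes equality of the dimensions.
\<close>

definition relu :: "real mat \<Rightarrow> real mat" where
  "relu X = map_mat (\<lambda>x. max x 0) X"

text \<open>The sum of the absolute values of all entries, not the induced operator norm.\<close>

definition norm1 :: "real mat \<Rightarrow> real" where
  "norm1 X = sum_mat (map_mat abs X)"

definition frobenius_norm :: "real mat \<Rightarrow> real" where
  "frobenius_norm X = sqrt (sum_mat (map_mat (\<lambda>x. x\<^sup>2) X))"

definition supp_mat :: "real mat \<Rightarrow> (nat \<times> nat) set" where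
  "supp_mat Y = {(i, j). i < dim_row Y \<and> j < dim_col Y \<and> Y $$ (i, j) \<noteq> 0}"

text \<open>
  \<open>restrict_mat \<Omega> W\<close> has the size of \<open>W\<close>. Index pairs outside that size are irrelevant, so the
  complement of an index set can be taken in the whole type.
\<close>

definition restrict_mat :: "(nat \<times> nat) set \<Rightarrow> real mat \<Rightarrow> real mat" where
  "restrict_mat \<Omega> W =
     mat (dim_row W) (dim_col W) (\<lambda>ij. if ij \<in> \<Omega> then W $$ ij else 0)"

definition nettrim_set :: "real \<Rightarrow> real mat \<Rightarrow> real mat \<Rightarrow> real mat \<Rightarrow> real mat set" where
  "nettrim_set \<epsilon> X Y V =
     {U \<in> carrier_mat (dim_row X) (dim_row Y).
        frobenius_norm (restrict_mat (supp_mat Y) (transpose_mat U * X - Y)) \<le> \<epsilon> \<and>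
        restrict_mat (- supp_mat Y) (transpose_mat U * X) \<le> restrict_mat (- supp_mat Y) V}"

text \<open>\<open>W l\<close> is the weight matrix of layer \<open>l\<close> for \<open>l \<ge> 1\<close>; the value \<open>W 0\<close> is never used.\<close>

primrec layer_outcome :: "(nat \<Rightarrow> real mat) \<Rightarrow> real mat \<Rightarrow> nat \<Rightarrow> real mat" where
  "layer_outcome W X 0 = X"
| "layer_outcome W X (Suc l) = relu (transpose_mat (W (Suc l)) * layer_outcome W X l)"

text \<open>
  \<open>Wh\<close> and \<open>Xh\<close> are the retrained weight matrices and layer outcomes, used at the indices
  \<open>1, \<dots>, L\<close> only. The minimizers need not be unique, so the scheme is a predicate on its
  possible outputs.
\<close>

definition cascade_net_trim ::
  "nat \<Rightarrow> (nat \<Rightarrow> real mat) \<Rightarrow> real mat \<Rightarrow> real \<Rightarrow> (nat \<Rightarrow> real)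
     \<Rightarrow> (nat \<Rightarrow> real mat) \<Rightarrow> (nat \<Rightarrow> real mat) \<Rightarrow> bool" where
  "cascade_net_trim L W X \<epsilon> \<gamma> Wh Xh \<longleftrightarrow>
     (let X1 = layer_outcome W X 1 in
        is_arg_min norm1
          (\<lambda>U. U \<in> nettrim_set \<epsilon> X X1 (0\<^sub>m (dim_row X1) (dim_col X1))) (Wh 1) \<and>
        Xh 1 = relu (transpose_mat (Wh 1) * X)) \<and>
     (\<forall>l\<in>{2..L}.
        let Xl = layer_outcome W X l;
            V = transpose_mat (W l) * Xh (l - 1);
            \<epsilon>l = \<gamma> l * frobenius_norm (restrict_mat (supp_mat Xl) (V - Xl))
        in is_arg_min norm1 (\<lambda>U. U \<in> nettrim_set \<epsilon>l (Xh (l - 1)) Xl V) (Wh l) \<and>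
           Xh l = relu (transpose_mat (Wh l) * Xh (l - 1)))"

end

theory Submission
  imports Defs "HOL-Analysis.L2_Norm"
begin

text \<open>
  Let \<open>Z\<close> be the original outcome of the previous layer, \<open>Z + D\<close> the retrained one, \<open>Y\<close> the original
  outcome of the current layer and \<open>V\<close> the bound in the constraint set. The error of the retrained
  current layer is controlled on the support of \<open>Y\<close> by the
  Frobenius constraint, and off it, where \<open>Y = 0\<close>, by the positive part of \<open>V\<close>. For
  \<open>V = W\<^sup>T (Z + D)\<close> and \<open>Y = ReLU (W\<^sup>T Z)\<close> each of these two parts is bounded, entry by entry, by
  \<open>W\<^sup>T D\<close>: on the support \<open>Y = W\<^sup>T Z\<close>, and off the support \<open>W\<^sup>T Z \<le> 0\<close>, so that
  \<open>max V 0 \<le> \<bar>V - W\<^sup>T Z\<bar>\<close>. Finally \<open>\<parallel>W\<^sup>T D\<parallel>\<^sub>F \<le> \<parallel>W\<parallel>\<^sub>F \<parallel>D\<parallel>\<^sub>F \<le> \<parallel>W\<parallel>\<^sub>1 \<parallel>D\<parallel>\<^sub>F = \<parallel>D\<parallel>\<^sub>F\<close>.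
\<close>

lemma frobenius_norm_eq_L2_set:
  "frobenius_norm A = L2_set (\<lambda>ij. A $$ ij) ({0..<dim_row A} \<times> {0..<dim_col A})"
  by (auto simp: frobenius_norm_def sum_mat_def L2_set_def intro!: sum.cong)

lemma frobenius_norm_nonneg: "0 \<le> frobenius_norm A"
  by (simp add: frobenius_norm_eq_L2_set)

lemma frobenius_norm_squared:
  "(frobenius_norm A)\<^sup>2 = (\<Sum>i<dim_row A. \<Sum>j<dim_col A. (A $$ (i, j))\<^sup>2)"
  by (simp add: frobenius_norm_eq_L2_set L2_set_def sum_nonneg sum.cartesian_product
      lessThan_atLeast0 case_prod_beta)

text \<open>Carries the normalisation of the weights, given in the entrywise l1 norm, over to the
  Frobenius norm, in which the errors propagate.\<close>

lemma frobenius_norm_le_norm1: "frobenius_norm A \<le> norm1 A"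
proof -
  have "norm1 A = (\<Sum>ij\<in>{0..<dim_row A} \<times> {0..<dim_col A}. \<bar>A $$ ij\<bar>)"
    by (auto simp: norm1_def sum_mat_def intro!: sum.cong)
  then show ?thesis
    by (simp add: frobenius_norm_eq_L2_set L2_set_le_sum_abs)
qed

text \<open>Cauchy-Schwarz bounds each entry of the product by a column of \<open>A\<close> against
  a column of \<open>B\<close>; the double sum of the squared bounds then factorises.\<close>

lemma frobenius_norm_transpose_mult_le:
  assumes "dim_row A = dim_row B"
  shows "frobenius_norm (transpose_mat A * B) \<le> frobenius_norm A * frobenius_norm B"
proof (rule power2_le_imp_le)
  define n where "n = dim_row B"
  have entry: "(transpose_mat A * B) $$ (i, j) = (\<Sum>k<n. A $$ (k, i) * B $$ (k, j))"
    if "i < dim_col A" "j < dim_col B" for i j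
    using that assms by (simp add: scalar_prod_def n_def lessThan_atLeast0)
  have CS: "(\<Sum>k<n. A $$ (k, i) * B $$ (k, j))\<^sup>2
      \<le> (\<Sum>k<n. (A $$ (k, i))\<^sup>2) * (\<Sum>k<n. (B $$ (k, j))\<^sup>2)" for i j
  proof -
    have "\<bar>\<Sum>k<n. A $$ (k, i) * B $$ (k, j)\<bar>
        \<le> L2_set (\<lambda>k. A $$ (k, i)) {..<n} * L2_set (\<lambda>k. B $$ (k, j)) {..<n}"
      by (rule order_trans[OF sum_abs]) (simp add: abs_mult L2_set_mult_ineq)
    from power_mono[OF this abs_ge_zero, of 2] have "(\<Sum>k<n. A $$ (k, i) * B $$ (k, j))\<^sup>2
        \<le> (L2_set (\<lambda>k. A $$ (k, i)) {..<n} * L2_set (\<lambda>k. B $$ (k, j)) {..<n})\<^sup>2"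
      by simp
    then show ?thesis
      by (simp add: L2_set_def power_mult_distrib sum_nonneg)
  qed
  have "(frobenius_norm (transpose_mat A * B))\<^sup>2
      = (\<Sum>i<dim_col A. \<Sum>j<dim_col B. (\<Sum>k<n. A $$ (k, i) * B $$ (k, j))\<^sup>2)"
    \<comment> \<open>\<open>index_mult_mat(1)\<close> competes with \<open>entry\<close>: it
      rewrites the same entries to scalar products.\<close>
    by (simp add: frobenius_norm_squared entry del: index_mult_mat(1))
  also have "\<dots> \<le> (\<Sum>i<dim_col A. \<Sum>j<dim_col B.
      (\<Sum>k<n. (A $$ (k, i))\<^sup>2) * (\<Sum>k<n. (B $$ (k, j))\<^sup>2))"
    by (intro sum_mono CS)
  also have "\<dots> = (\<Sum>i<dim_col A. \<Sum>k<n. (A $$ (k, i))\<^sup>2) * (\<Sum>j<dim_col B. \<Sum>k<n. (B $$ (k, j))\<^sup>2)"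
    by (rule sum_product[symmetric])
  also have "\<dots> = (frobenius_norm A * frobenius_norm B)\<^sup>2"
    unfolding power_mult_distrib frobenius_norm_squared
    \<comment> \<open>\<open>frobenius_norm_squared\<close> sums over rows first, whereas the
      factors here sum over columns first.\<close>
    by (subst (1 2) sum.swap) (simp add: n_def assms)
  finally show "(frobenius_norm (transpose_mat A * B))\<^sup>2 \<le> (frobenius_norm A * frobenius_norm B)\<^sup>2" .
qed (simp add: frobenius_norm_nonneg)

lemma relu_dim [simp]: "dim_row (relu A) = dim_row A" "dim_col (relu A) = dim_col A"
  by (simp_all add: relu_def)

lemma relu_index [simp]:
  "i < dim_row A \<Longrightarrow> j < dim_col A \<Longrightarrow> relu A $$ (i, j) = max (A $$ (i, j)) 0"
  by (simp add: relu_def)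

lemma relu_zero: "relu (0\<^sub>m m n) = 0\<^sub>m m n"
  by (rule eq_matI) auto

lemma restrict_mat_dim [simp]:
  "dim_row (restrict_mat S A) = dim_row A" "dim_col (restrict_mat S A) = dim_col A"
  by (simp_all add: restrict_mat_def)

lemma restrict_mat_index [simp]:
  "i < dim_row A \<Longrightarrow> j < dim_col A \<Longrightarrow>
    restrict_mat S A $$ (i, j) = (if (i, j) \<in> S then A $$ (i, j) else 0)"
  by (simp add: restrict_mat_def)

lemma restrict_mat_zero: "restrict_mat S (0\<^sub>m m n) = 0\<^sub>m m n"
  by (rule eq_matI) auto

text \<open>The support of \<open>Y\<close> and its complement are disjoint, so the two error
  contributions add up as squares. An arbitrary \<open>V\<close> covers both the first layer, where
  it is zero, and the later ones.\<close>

lemma nettrim_set_error: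
  assumes U: "U \<in> nettrim_set e X Y V"
    and Y: "Y \<in> carrier_mat m p"
    and X: "dim_col X = p"
    and nonneg: "\<And>i j. i < m \<Longrightarrow> j < p \<Longrightarrow> 0 \<le> Y $$ (i, j)"
  shows "(frobenius_norm (relu (transpose_mat U * X) - Y))\<^sup>2
    \<le> e\<^sup>2 + (frobenius_norm (restrict_mat (- supp_mat Y) (relu V)))\<^sup>2"
proof -
  define T where "T = transpose_mat U * X"
  have dT: "dim_row T = m" "dim_col T = p" and dY: "dim_row Y = m" "dim_col Y = p"
    using U Y X by (auto simp: T_def nettrim_set_def)
  have F: "frobenius_norm (restrict_mat (supp_mat Y) (T - Y)) \<le> e"
    and le: "restrict_mat (- supp_mat Y) T \<le> restrict_mat (- supp_mat Y) V"
    using U by (auto simp: T_def nettrim_set_def)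
  \<comment> \<open>The order on matrices forces equal dimensions.\<close>
  have dV: "dim_row V = m" "dim_col V = p"
    using le dT by (auto simp: less_eq_mat_def)
  have off: "T $$ (i, j) \<le> V $$ (i, j)" if "i < m" "j < p" "Y $$ (i, j) = 0" for i j
    using le that dT dV dY by (force simp: less_eq_mat_def supp_mat_def)
  have entry: "((relu T - Y) $$ (i, j))\<^sup>2 \<le> (restrict_mat (supp_mat Y) (T - Y) $$ (i, j))\<^sup>2
      + (restrict_mat (- supp_mat Y) (relu V) $$ (i, j))\<^sup>2" if ij: "i < m" "j < p" for i j
  proof (cases "Y $$ (i, j) = 0")
    case True
    then have "(max (T $$ (i, j)) 0)\<^sup>2 \<le> (max (V $$ (i, j)) 0)\<^sup>2"
      using off[OF ij] by (intro power_mono) auto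
    then show ?thesis
      using True ij by (simp add: dT dY dV supp_mat_def)
  next
    case False
    \<comment> \<open>Since \<open>Y\<close> is nonnegative here, \<open>relu\<close> fixes its
      entry, and \<open>relu\<close> is nonexpansive.\<close>
    have "\<bar>max (T $$ (i, j)) 0 - Y $$ (i, j)\<bar> \<le> \<bar>T $$ (i, j) - Y $$ (i, j)\<bar>"
      using nonneg[OF ij] by (simp add: max_def)
    then show ?thesis
      using False ij by (simp add: dT dY dV supp_mat_def abs_le_square_iff)
  qed
  have "(frobenius_norm (relu T - Y))\<^sup>2 \<le>
    (frobenius_norm (restrict_mat (supp_mat Y) (T - Y)))\<^sup>2 +
    (frobenius_norm (restrict_mat (- supp_mat Y) (relu V)))\<^sup>2"
    unfolding frobenius_norm_squared restrict_mat_dim relu_dim index_minus_mat(2,3) dT dY dV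
      sum.distrib[symmetric]
    by (intro sum_mono entry) simp_all
  also have "\<dots> \<le> e\<^sup>2 + (frobenius_norm (restrict_mat (- supp_mat Y) (relu V)))\<^sup>2"
    using F by (simp add: frobenius_norm_nonneg power_mono)
  finally show ?thesis by (simp add: T_def)
qed

text \<open>Each entry lies in exactly one of the two restrictions, so comparing squares entry by
  entry costs no constant. The support of \<open>relu A\<close> is where \<open>A\<close> is
  positive.\<close>

lemma frobenius_norm_relu_split_le:
  assumes "dim_row A = dim_row V" "dim_col A = dim_col V"
  shows "(frobenius_norm (restrict_mat (supp_mat (relu A)) (V - relu A)))\<^sup>2
      + (frobenius_norm (restrict_mat (- supp_mat (relu A)) (relu V)))\<^sup>2
    \<le> (frobenius_norm (V - A))\<^sup>2"
proof -
  have entry: "(restrict_mat (supp_mat (relu A)) (V - relu A) $$ (i, j))\<^sup>2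
      + (restrict_mat (- supp_mat (relu A)) (relu V) $$ (i, j))\<^sup>2 \<le> ((V - A) $$ (i, j))\<^sup>2"
    if ij: "i < dim_row V" "j < dim_col V" for i j
  proof (cases "A $$ (i, j) \<le> 0")
    case True
    then have "\<bar>max (V $$ (i, j)) 0\<bar> \<le> \<bar>V $$ (i, j) - A $$ (i, j)\<bar>"
      by (simp add: max_def)
    then have "(max (V $$ (i, j)) 0)\<^sup>2 \<le> (V $$ (i, j) - A $$ (i, j))\<^sup>2"
      by (simp only: abs_le_square_iff)
    then show ?thesis
      using True ij assms by (simp add: supp_mat_def)
  next
    case False
    then show ?thesis
      using ij assms by (simp add: supp_mat_def)
  qed
  show ?thesis
    unfolding frobenius_norm_squared restrict_mat_dim relu_dim index_minus_mat(2,3) assms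
      sum.distrib[symmetric]
    by (intro sum_mono entry) simp_all
qed

lemma nettrim_layer_error:
  assumes U: "U \<in> nettrim_set (g * frobenius_norm (restrict_mat (supp_mat Y) (V - Y))) Z' Y V"
    and Y: "Y = relu (transpose_mat W * Z)" and V: "V = transpose_mat W * Z'"
    and W: "W \<in> carrier_mat n m" and Z: "Z \<in> carrier_mat n p" and Z': "Z' \<in> carrier_mat n p"
    and g: "1 \<le> g"
  shows "frobenius_norm (relu (transpose_mat U * Z') - Y) \<le> g * norm1 W * frobenius_norm (Z' - Z)"
proof -
  define a where "a = (frobenius_norm (restrict_mat (supp_mat Y) (V - Y)))\<^sup>2"
  define b where "b = (frobenius_norm (restrict_mat (- supp_mat Y) (relu V)))\<^sup>2"
  have "(frobenius_norm (relu (transpose_mat U * Z') - Y))\<^sup>2 \<le> g\<^sup>2 * a + b"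
    unfolding a_def b_def power_mult_distrib[symmetric]
    by (rule nettrim_set_error[OF U, of m p]) (use Y W Z Z' in auto)
  \<comment> \<open>The inflation affects only the on-support part \<open>a\<close>; as
    \<open>g\<close> is at least 1, the off-support part \<open>b\<close> can share the
    factor.\<close>
  also have "\<dots> \<le> g\<^sup>2 * (a + b)"
    using g mult_right_mono[of 1 "g\<^sup>2" b] by (simp add: b_def distrib_left)
  \<comment> \<open>The chain continues inside the factor \<open>g\<^sup>2\<close>; monotonicity of
    multiplication by it is discharged when the chain is closed.\<close>
  also have "a + b \<le> (frobenius_norm (V - transpose_mat W * Z))\<^sup>2"
    unfolding a_def b_def Y by (rule frobenius_norm_relu_split_le) (use V W Z Z' in auto)
  also have "V - transpose_mat W * Z = transpose_mat W * (Z' - Z)"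
    unfolding V by (rule mult_minus_distrib_mat[symmetric]) (use W Z Z' in auto)
  finally have "(frobenius_norm (relu (transpose_mat U * Z') - Y))\<^sup>2
      \<le> (g * frobenius_norm (transpose_mat W * (Z' - Z)))\<^sup>2"
    by (simp add: power_mult_distrib mult_left_mono)
  then have "frobenius_norm (relu (transpose_mat U * Z') - Y)
      \<le> g * frobenius_norm (transpose_mat W * (Z' - Z))"
    by (rule power2_le_imp_le) (use g frobenius_norm_nonneg in simp)
  also have "\<dots> \<le> g * (frobenius_norm W * frobenius_norm (Z' - Z))"
    by (intro mult_left_mono frobenius_norm_transpose_mult_le) (use W Z Z' g in auto)
  also have "\<dots> \<le> g * (norm1 W * frobenius_norm (Z' - Z))"
    by (intro mult_left_mono mult_right_mono frobenius_norm_le_norm1 frobenius_norm_nonneg)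
       (use g in auto)
  finally show ?thesis by simp
qed

theorem theorem2:
  fixes L P :: nat
    and N :: "nat \<Rightarrow> nat"
    and X :: "real mat"
    and W Wh Xh :: "nat \<Rightarrow> real mat"
    and \<epsilon> :: real
    and \<gamma> :: "nat \<Rightarrow> real"
  assumes "X \<in> carrier_mat (N 0) P"
    and "\<And>l. l \<in> {1..L} \<Longrightarrow> W l \<in> carrier_mat (N (l - 1)) (N l)"
    and "\<And>l. l \<in> {1..L} \<Longrightarrow> norm1 (W l) = 1"
    and "\<epsilon> \<ge> 0"
    and "\<And>l. l \<in> {2..L} \<Longrightarrow> \<gamma> l \<ge> 1"
    and "cascade_net_trim L W X \<epsilon> \<gamma> Wh Xh"
  shows "\<forall>l\<in>{1..L}. frobenius_norm (Xh l - layer_outcome W X l) \<le> \<epsilon> * (\<Prod>j=2..l. \<gamma> j)"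
proof
  have layer: "layer_outcome W X l \<in> carrier_mat (N l) P" if "l \<le> L" for l
    using that
  proof (induction l)
    case (Suc l)
    then show ?case using assms(2)[of "Suc l"] by auto
  qed (simp add: assms(1))
  \<comment> \<open>Starts at \<open>Suc l\<close> because layer 0 is the input \<open>X\<close>,
    whose entries may be negative.\<close>
  have layer_nonneg: "0 \<le> layer_outcome W X (Suc l) $$ (i, j)"
    if "Suc l \<le> L" "i < N (Suc l)" "j < P" for l i j
    using that carrier_matD[OF layer[OF that(1)]] by simp
  fix l assume "l \<in> {1..L}"
  then have "1 \<le> l" "l \<le> L" by auto
  \<comment> \<open>The dimensions of \<open>Xh l\<close> join the induction claim because the error
    bound for the next layer requires them.\<close>
  then have "Xh l \<in> carrier_mat (N l) P \<and>
    frobenius_norm (Xh l - layer_outcome W X l) \<le> \<epsilon> * (\<Prod>j=2..l. \<gamma> j)"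
  proof (induction l rule: dec_induct)
    case base
    define Y where "Y = layer_outcome W X 1"
    have U: "Wh 1 \<in> nettrim_set \<epsilon> X Y (0\<^sub>m (dim_row Y) (dim_col Y))"
      and Xh: "Xh 1 = relu (transpose_mat (Wh 1) * X)"
      using assms(6) by (simp_all add: cascade_net_trim_def is_arg_min_def Y_def Let_def)
    have Y: "Y \<in> carrier_mat (N 1) P"
      using layer[of 1] base by (simp add: Y_def)
    have "(frobenius_norm (Xh 1 - Y))\<^sup>2 \<le> \<epsilon>\<^sup>2
        + (frobenius_norm (restrict_mat (- supp_mat Y) (relu (0\<^sub>m (dim_row Y) (dim_col Y)))))\<^sup>2"
      unfolding Xh
      by (rule nettrim_set_error[OF U Y]) (use assms(1) layer_nonneg[of 0] base Y_def in auto)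
    \<comment> \<open>With \<open>V\<close> zero, the off-support term vanishes.\<close>
    also have "\<dots> = \<epsilon>\<^sup>2"
      by (simp add: frobenius_norm_squared relu_zero restrict_mat_zero)
    finally have "frobenius_norm (Xh 1 - Y) \<le> \<epsilon>"
      using assms(4) by (rule power2_le_imp_le)
    moreover have "Xh 1 \<in> carrier_mat (N 1) P"
      using U Y assms(1) unfolding Xh by (intro carrier_matI) (auto simp: nettrim_set_def)
    ultimately show ?case by (simp add: Y_def)
  next
    case (step l)
    then have IH: "Xh l \<in> carrier_mat (N l) P"
      "frobenius_norm (Xh l - layer_outcome W X l) \<le> \<epsilon> * (\<Prod>j=2..l. \<gamma> j)"
      by auto
    define Y where "Y = layer_outcome W X (Suc l)"
    define V where "V = transpose_mat (W (Suc l)) * Xh l"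
    have l: "Suc l \<in> {2..L}" using step by auto
    have U: "Wh (Suc l) \<in> nettrim_set
        (\<gamma> (Suc l) * frobenius_norm (restrict_mat (supp_mat Y) (V - Y))) (Xh l) Y V"
      and Xh: "Xh (Suc l) = relu (transpose_mat (Wh (Suc l)) * Xh l)"
      using assms(6)[unfolded cascade_net_trim_def, THEN conjunct2, THEN bspec, OF l]
      by (simp_all add: Let_def is_arg_min_def Y_def V_def)
    have g: "1 \<le> \<gamma> (Suc l)" using assms(5)[OF l] .
    have "frobenius_norm (Xh (Suc l) - Y)
        \<le> \<gamma> (Suc l) * norm1 (W (Suc l)) * frobenius_norm (Xh l - layer_outcome W X l)"
      unfolding Xh
      by (rule nettrim_layer_error[OF U _ V_def _ _ IH(1) g, of _ "N (Suc l)"])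
         (use assms(2)[of "Suc l"] layer[of l] step in \<open>auto simp: Y_def\<close>)
    also have "\<dots> = \<gamma> (Suc l) * frobenius_norm (Xh l - layer_outcome W X l)"
      using assms(3)[of "Suc l"] step by simp
    also have "\<dots> \<le> \<gamma> (Suc l) * (\<epsilon> * (\<Prod>j=2..l. \<gamma> j))"
      using IH(2) g by (intro mult_left_mono) auto
    \<comment> \<open>As \<open>l\<close> is at least 1, the index \<open>Suc l\<close> belongs to
      the range starting at 2, so its factor enters the product.\<close>
    also have "\<dots> = \<epsilon> * (\<Prod>j=2..Suc l. \<gamma> j)"
      using step by (simp add: prod.nat_ivl_Suc')
    finally have "frobenius_norm (Xh (Suc l) - Y) \<le> \<epsilon> * (\<Prod>j=2..Suc l. \<gamma> j)" .
    moreover have "Xh (Suc l) \<in> carrier_mat (N (Suc l)) P"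
      using U IH(1) layer[of "Suc l", folded Y_def] step
      by (intro carrier_matI) (auto simp: Xh nettrim_set_def)
    ultimately show ?case by (simp add: Y_def)
  qed
  then show "frobenius_norm (Xh l - layer_outcome W X l) \<le> \<epsilon> * (\<Prod>j=2..l. \<gamma> j)" ..
qed

end
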